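(* Let $p$ be a prime and let $\alpha$ be, locally at $p$, a convolution product in normal form of valence $\langle r,s\rangle$ with $r\ge1$ and $s\ge1$ (a mixed product). Then $\alpha$ is of type 4 at $p$: $\alpha(p^n)\neq0$ for infinitely many $n$, and infinitely many of the parameters $t_j$ of $\alpha$ at $p$ are non-zero.
   Context: A multiplicative arithmetic function is a function $\alpha:\mathbb{N}_{\ge1}\to\mathbb{C}$, not identically zero, with $\alpha(mn)=\alpha(m)\alpha(n)$ whenever $\gcd(m,n)=1$. Dirichlet convolution is $(\alpha*\beta)(n)=\sum_{d\mid n}\alpha(d)\beta(n/d)$. Generalized Fibonacci polynomials: $F_0=1$ and, for $n\ge1$, $F_n(t_1,\dots,t_n)=\sum\binom{a_1+\dots+a_n}{a_1,\dots,a_n}t_1^{a_1}\cdots t_n^{a_n}$, the sum being over tuples of non-negative integers with $\sum_j ja_j=n$. The parameters of $\alpha$ at $p$ are the unique complex numbers $t_1,t_2,\dots$ such that $F_n(t_1,\dots,t_n)=\alpha(p^n)$ for all $n\ge0$. A degree-1 function at $p$ is one with values $p^n\mapsto b^n$ $(n\ge0)$ for some complex $b\ne0$. A product of valence $\langle r,s\rangle$ is a convolution product $\beta_1*\dots*\beta_r*\gamma_1^{-1}*\dots*\gamma_s^{-1}$ with all $\beta_i,\gamma_j$ of degree 1 at $p$; it is in normal form if no two factors are mutually inverse, i.e. $\beta_i(p)\ne\gamma_j(p)$ for all $i,j$. *)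

theory Defs
  imports Complex_Main "HOL-Computational_Algebra.Computational_Algebra"
begin

section \<open>Arithmetic functions and Dirichlet convolution\<close>

text \<open>
  Arithmetic functions are functions \<open>nat \<Rightarrow> complex\<close> whose value at \<open>0\<close> is irrelevant.
\<close>

definition multiplicative_fun :: "(nat \<Rightarrow> complex) \<Rightarrow> bool" where
  "multiplicative_fun f \<longleftrightarrow>
     (\<exists>n\<ge>1. f n \<noteq> 0) \<and>
     (\<forall>m\<ge>1. \<forall>n\<ge>1. coprime m n \<longrightarrow> f (m * n) = f m * f n)"

definition dirichlet_conv :: "(nat \<Rightarrow> complex) \<Rightarrow> (nat \<Rightarrow> complex) \<Rightarrow> nat \<Rightarrow> complex" where
  "dirichlet_conv f g n = (\<Sum>d | d dvd n. f d * g (n div d))"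

definition dirichlet_unit :: "nat \<Rightarrow> complex" where
  "dirichlet_unit n = (if n = 1 then 1 else 0)"

text \<open>
  The inverse for Dirichlet convolution, by its usual recursion; it is characterised by
  \<open>dirichlet_conv_inverse\<close> and \<open>dirichlet_inverse_unique\<close> below.
\<close>

function dirichlet_inverse :: "(nat \<Rightarrow> complex) \<Rightarrow> nat \<Rightarrow> complex" where
  "dirichlet_inverse f n =
     (if n = 0 then 0
      else if n = 1 then 1 / f 1
      else - (\<Sum>d | d dvd n \<and> d < n. f (n div d) * dirichlet_inverse f d) / f 1)"
  by auto
termination by (relation "Wellfounded.measure snd") auto

declare dirichlet_inverse.simps [simp del]

lemma multiplicative_fun_1:
  assumes "multiplicative_fun f"
  shows "f 1 = 1"
proof -
  obtain n where n: "n \<ge> 1" "f n \<noteq> 0"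
    using assms by (auto simp: multiplicative_fun_def)
  have "f (n * 1) = f n * f 1"
    using assms n(1) unfolding multiplicative_fun_def by (metis coprime_1_right order_refl)
  thus ?thesis using n(2) by simp
qed

lemma dirichlet_conv_0 [simp]: "dirichlet_conv f g 0 = 0"
  by (simp add: dirichlet_conv_def)

lemma dirichlet_conv_commute: "dirichlet_conv f g = dirichlet_conv g f"
proof
  fix n
  show "dirichlet_conv f g n = dirichlet_conv g f n"
  proof (cases "n = 0")
    case False
    thus ?thesis unfolding dirichlet_conv_def
      by (intro sum.reindex_bij_witness[of _ "\<lambda>d. n div d" "\<lambda>d. n div d"]) auto
  qed simp
qed

lemma dirichlet_conv_split:
  assumes "n > 0"
  shows "dirichlet_conv f g n = f 1 * g n + (\<Sum>d | d dvd n \<and> d < n. f (n div d) * g d)"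
proof -
  have "dirichlet_conv f g n = (\<Sum>d | d dvd n. f (n div d) * g d)"
    by (subst dirichlet_conv_commute) (simp add: dirichlet_conv_def mult.commute)
  also have "{d. d dvd n} = insert n {d. d dvd n \<and> d < n}"
    using assms by (auto dest: dvd_imp_le)
  finally show ?thesis using assms by (simp add: finite_subset[OF _ finite_lessThan[of n]] subset_eq)
qed

lemma dirichlet_conv_inverse:
  assumes "f 1 \<noteq> 0"
  shows "dirichlet_conv f (dirichlet_inverse f) = dirichlet_unit"
proof
  fix n :: nat
  consider "n = 0" | "n = 1" | "n > 1" by linarith
  thus "dirichlet_conv f (dirichlet_inverse f) n = dirichlet_unit n"
  proof cases
    case 2
    thus ?thesis using assms
      by (simp add: dirichlet_conv_def dirichlet_unit_def dirichlet_inverse.simps[of f 1]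
               del: One_nat_def)
  next
    case 3
    thus ?thesis using assms
      by (subst dirichlet_conv_split, simp, subst dirichlet_inverse.simps)
         (simp add: dirichlet_unit_def)
  qed (simp add: dirichlet_unit_def)
qed

lemma dirichlet_inverse_unique:
  assumes "f 1 \<noteq> 0" "\<And>n. n \<ge> 1 \<Longrightarrow> dirichlet_conv f g n = dirichlet_unit n" "n \<ge> 1"
  shows "g n = dirichlet_inverse f n"
  using assms(3)
proof (induction n rule: less_induct)
  case (less n)
  have "dirichlet_conv f g n = dirichlet_conv f (dirichlet_inverse f) n"
    using less.prems assms(1,2) by (simp add: dirichlet_conv_inverse)
  moreover have "(\<Sum>d | d dvd n \<and> d < n. f (n div d) * g d) =
                 (\<Sum>d | d dvd n \<and> d < n. f (n div d) * dirichlet_inverse f d)"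
    using less by (intro sum.cong refl) (auto simp: Suc_le_eq intro!: Nat.gr0I)
  ultimately show ?case
    using less.prems assms(1) by (simp add: dirichlet_conv_split)
qed


section \<open>Generalized Fibonacci polynomials and parameters\<close>

text \<open>
  A tuple \<open>(a\<^sub>1, \<dots>, a\<^sub>n)\<close> is encoded as a function on \<open>nat\<close> vanishing outside \<open>{1..n}\<close>.
\<close>

definition weighted_tuples :: "nat \<Rightarrow> (nat \<Rightarrow> nat) set" where
  "weighted_tuples n = {a. (\<forall>j. j \<notin> {1..n} \<longrightarrow> a j = 0) \<and> (\<Sum>j=1..n. j * a j) = n}"

definition gen_fib :: "nat \<Rightarrow> (nat \<Rightarrow> complex) \<Rightarrow> complex" where
  "gen_fib n t =
     (\<Sum>a\<in>weighted_tuples n.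
        (fact (\<Sum>j=1..n. a j) / (\<Prod>j=1..n. fact (a j))) * (\<Prod>j=1..n. t j ^ a j))"

text \<open>
  The parameters are indexed by \<open>j \<ge> 1\<close>; the unused entry at \<open>0\<close> is set to \<open>0\<close> to make the
  sequence unique (see \<open>parameters_ex1\<close>).
\<close>

definition parameters :: "nat \<Rightarrow> (nat \<Rightarrow> complex) \<Rightarrow> nat \<Rightarrow> complex" where
  "parameters p \<alpha> = (THE t. t 0 = 0 \<and> (\<forall>n. gen_fib n t = \<alpha> (p ^ n)))"

lemma finite_weighted_tuples: "finite (weighted_tuples n)"
proof (rule finite_subset)
  show "weighted_tuples n \<subseteq> {a. \<forall>j. (j \<in> {1..n} \<longrightarrow> a j \<in> {..n}) \<and> (j \<notin> {1..n} \<longrightarrow> a j = 0)}"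
  proof
    fix a assume a: "a \<in> weighted_tuples n"
    have "a j \<in> {..n}" if j: "j \<in> {1..n}" for j
    proof -
      have "a j \<le> j * a j" using j by simp
      also have "\<dots> \<le> (\<Sum>j=1..n. j * a j)"
        using j by (intro member_le_sum) auto
      finally show ?thesis using a by (simp add: weighted_tuples_def)
    qed
    moreover have "a j = 0" if "j \<notin> {1..n}" for j
      using a that by (simp add: weighted_tuples_def)
    ultimately show "a \<in> {a. \<forall>j. (j \<in> {1..n} \<longrightarrow> a j \<in> {..n}) \<and> (j \<notin> {1..n} \<longrightarrow> a j = 0)}"
      by blast
  qed
  show "finite {a. \<forall>j. (j \<in> {1..n} \<longrightarrow> a j \<in> {..n}) \<and> (j \<notin> {1..n} \<longrightarrow> a j = (0::nat))}"
    by (rule finite_set_of_finite_funs) auto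
qed

lemma gen_fib_0 [simp]: "gen_fib 0 t = 1"
proof -
  have "weighted_tuples 0 = {\<lambda>_. 0}" by (auto simp: weighted_tuples_def)
  thus ?thesis by (simp add: gen_fib_def)
qed

definition gen_fib_rest :: "nat \<Rightarrow> (nat \<Rightarrow> complex) \<Rightarrow> complex" where
  "gen_fib_rest n t =
     (\<Sum>a\<in>weighted_tuples n - {\<lambda>j. if j = n then 1 else 0}.
        (fact (\<Sum>j=1..n. a j) / (\<Prod>j=1..n. fact (a j))) * (\<Prod>j=1..<n. t j ^ a j))"

lemma gen_fib_decompose:
  assumes "n > 0"
  shows "gen_fib n t = t n + gen_fib_rest n t"
proof -
  let ?e = "\<lambda>j::nat. if j = n then 1 else 0 :: nat"
  have e: "?e \<in> weighted_tuples n"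
    using assms by (auto simp: weighted_tuples_def if_distrib[of "\<lambda>x. _ * x"] sum.delta cong: if_cong)
  have split: "{1..n} = insert n {1..<n}" using assms by auto
  have zero: "a n = 0" if a: "a \<in> weighted_tuples n" "a \<noteq> ?e" for a
  proof (rule ccontr)
    assume nz: "a n \<noteq> 0"
    have eq: "n * a n + (\<Sum>j=1..<n. j * a j) = n"
      using a(1) unfolding weighted_tuples_def split by simp
    have ge: "n * a n \<ge> n" using nz by simp
    hence "(\<Sum>j=1..<n. j * a j) = 0" and "n * a n = n" using eq by linarith+
    hence "\<forall>j\<in>{1..<n}. a j = 0" and "a n = 1" using assms by auto
    moreover have "\<forall>j. j \<notin> {1..n} \<longrightarrow> a j = 0" using a(1) by (simp add: weighted_tuples_def)
    ultimately have "a j = ?e j" for j unfolding split by (cases "j = n"; cases "j \<in> {1..<n}") auto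
    hence "a = ?e" by blast
    thus False using a(2) by simp
  qed
  let ?f = "\<lambda>a. (fact (\<Sum>j=1..n. a j) / (\<Prod>j=1..n. fact (a j))) * (\<Prod>j=1..n. t j ^ a j)"
  have "gen_fib n t = ?f ?e + (\<Sum>a\<in>weighted_tuples n - {?e}. ?f a)"
    unfolding gen_fib_def by (rule sum.remove[OF finite_weighted_tuples e])
  also have "?f ?e = t n"
    unfolding split by simp
  also have "(\<Sum>a\<in>weighted_tuples n - {?e}. ?f a) = gen_fib_rest n t"
    unfolding gen_fib_rest_def
  proof (intro sum.cong refl arg_cong2[where f = "(*)"])
    fix a assume "a \<in> weighted_tuples n - {?e}"
    hence "a n = 0" using zero by blast
    thus "(\<Prod>j=1..n. t j ^ a j) = (\<Prod>j=1..<n. t j ^ a j)"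
      unfolding split by simp
  qed
  finally show ?thesis .
qed

lemma gen_fib_rest_cong:
  assumes "\<And>j. j < n \<Longrightarrow> t j = t' j"
  shows "gen_fib_rest n t = gen_fib_rest n t'"
  using assms unfolding gen_fib_rest_def by (intro sum.cong refl arg_cong2[where f = "(*)"] prod.cong) auto

fun params_rec :: "(nat \<Rightarrow> complex) \<Rightarrow> nat \<Rightarrow> complex" where
  "params_rec c n =
     (if n = 0 then 0 else c n - gen_fib_rest n (\<lambda>j. if j < n then params_rec c j else 0))"

declare params_rec.simps [simp del]

lemma parameters_ex1:
  assumes "\<alpha> 1 = 1"
  shows "\<exists>!t. t 0 = 0 \<and> (\<forall>n. gen_fib n t = \<alpha> (p ^ n))"
proof (rule ex1I)
  let ?t = "params_rec (\<lambda>n. \<alpha> (p ^ n))"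
  have "gen_fib n ?t = \<alpha> (p ^ n)" for n
  proof (cases "n = 0")
    case False
    have "gen_fib_rest n (\<lambda>j. if j < n then ?t j else 0) = gen_fib_rest n ?t"
      by (rule gen_fib_rest_cong) auto
    thus ?thesis using False
      by (simp add: gen_fib_decompose params_rec.simps[of _ n])
  qed (use assms in simp)
  thus "?t 0 = 0 \<and> (\<forall>n. gen_fib n ?t = \<alpha> (p ^ n))"
    by (simp add: params_rec.simps)
next
  fix t assume t: "t 0 = 0 \<and> (\<forall>n. gen_fib n t = \<alpha> (p ^ n))"
  show "t = params_rec (\<lambda>n. \<alpha> (p ^ n))"
  proof
    fix n show "t n = params_rec (\<lambda>n. \<alpha> (p ^ n)) n"
    proof (induction n rule: less_induct)
      case (less n)
      show ?case
      proof (cases "n = 0")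
        case False
        have "gen_fib_rest n (\<lambda>j. if j < n then params_rec (\<lambda>n. \<alpha> (p ^ n)) j else 0)
              = gen_fib_rest n t"
          by (rule gen_fib_rest_cong) (use less in auto)
        moreover have "t n + gen_fib_rest n t = \<alpha> (p ^ n)"
          using t False gen_fib_decompose[of n t] by auto
        ultimately show ?thesis using False
          by (simp add: params_rec.simps[of _ n] algebra_simps)
      qed (use t in \<open>simp add: params_rec.simps\<close>)
    qed
  qed
qed

lemma parameters_0: "\<alpha> 1 = 1 \<Longrightarrow> parameters p \<alpha> 0 = 0"
  and gen_fib_parameters: "\<alpha> 1 = 1 \<Longrightarrow> gen_fib n (parameters p \<alpha>) = \<alpha> (p ^ n)"
  using theI'[OF parameters_ex1[of \<alpha> p]] unfolding parameters_def by auto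


section \<open>Local products of degree 1 functions\<close>

definition degree_one_at :: "nat \<Rightarrow> (nat \<Rightarrow> complex) \<Rightarrow> bool" where
  "degree_one_at p \<beta> \<longleftrightarrow> multiplicative_fun \<beta> \<and> (\<exists>b. b \<noteq> 0 \<and> (\<forall>n. \<beta> (p ^ n) = b ^ n))"

definition dirichlet_product :: "(nat \<Rightarrow> complex) list \<Rightarrow> nat \<Rightarrow> complex" where
  "dirichlet_product fs = foldr dirichlet_conv fs dirichlet_unit"

definition normal_form_product_at :: "nat \<Rightarrow> (nat \<Rightarrow> complex) \<Rightarrow> nat \<Rightarrow> nat \<Rightarrow> bool" where
  "normal_form_product_at p \<alpha> r s \<longleftrightarrow>
     (\<exists>\<beta>s \<gamma>s. length \<beta>s = r \<and> length \<gamma>s = s \<and>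
        (\<forall>\<beta>\<in>set \<beta>s. degree_one_at p \<beta>) \<and> (\<forall>\<gamma>\<in>set \<gamma>s. degree_one_at p \<gamma>) \<and>
        (\<forall>\<beta>\<in>set \<beta>s. \<forall>\<gamma>\<in>set \<gamma>s. \<beta> p \<noteq> \<gamma> p) \<and>
        (\<forall>n. \<alpha> (p ^ n) = dirichlet_product (\<beta>s @ map dirichlet_inverse \<gamma>s) (p ^ n)))"

definition type4_at :: "nat \<Rightarrow> (nat \<Rightarrow> complex) \<Rightarrow> bool" where
  "type4_at p \<alpha> \<longleftrightarrow>
     infinite {n. \<alpha> (p ^ n) \<noteq> 0} \<and> infinite {j. j \<ge> 1 \<and> parameters p \<alpha> j \<noteq> 0}"

end

theory Submission
  imports Defs
begin

text \<open>
  With \<open>A(X) = (\<Sum>n. \<alpha>(p\<^sup>n) X\<^sup>n)\<close>, \<open>Q(X) = (\<Prod>i. 1 - \<beta>\<^sub>i(p) X)\<close> and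
  \<open>P(X) = (\<Prod>j. 1 - \<gamma>\<^sub>j(p) X)\<close>, the product representation says \<open>Q A = P\<close>, and the
  parameters satisfy \<open>A (1 - \<Sum>j. t\<^sub>j X\<^sup>j) = 1\<close>, so \<open>P (1 - \<Sum>j. t\<^sub>j X\<^sup>j) = Q\<close>.
  Finitely many non-zero values would give \<open>Q dvd P\<close> and finitely many non-zero parameters
  \<open>P dvd Q\<close>; both are impossible, since \<open>P\<close> and \<open>Q\<close> are non-constant without a common root.
\<close>

section \<open>Bell series\<close>

definition bell_series :: "nat \<Rightarrow> (nat \<Rightarrow> complex) \<Rightarrow> complex fps" where
  "bell_series p f = Abs_fps (\<lambda>n. f (p ^ n))"

lemma bell_series_nth [simp]: "bell_series p f $ n = f (p ^ n)"
  by (simp add: bell_series_def)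

text \<open>The divisors of \<open>p ^ n\<close> are exactly the powers \<open>p ^ i\<close> with
  \<open>i \<le> n\<close>, so at prime powers Dirichlet convolution is the Cauchy product.\<close>

lemma bell_series_dirichlet_conv:
  assumes "prime p"
  shows "bell_series p (dirichlet_conv f g) = bell_series p f * bell_series p g"
proof (rule fps_ext)
  fix n
  have p: "p > 1" using assms by (rule prime_gt_1_nat)
  have "{d. d dvd p ^ n} = (\<lambda>i. p ^ i) ` {0..n}"
    using assms by (auto simp: divides_primepow_nat le_imp_power_dvd)
  moreover have "inj_on (\<lambda>i. p ^ i) {0..n}"
    using p by (auto intro!: inj_onI)
  ultimately have "dirichlet_conv f g (p ^ n) = (\<Sum>i=0..n. f (p ^ i) * g (p ^ n div p ^ i))"
    unfolding dirichlet_conv_def by (simp add: sum.reindex)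
  also have "\<dots> = (\<Sum>i=0..n. f (p ^ i) * g (p ^ (n - i)))"
    using p by (intro sum.cong refl) (auto simp: power_diff)
  finally show "bell_series p (dirichlet_conv f g) $ n = (bell_series p f * bell_series p g) $ n"
    by (simp add: fps_mult_nth)
qed

lemma bell_series_dirichlet_unit:
  assumes "prime p"
  shows "bell_series p dirichlet_unit = 1"
  using prime_gt_1_nat[OF assms] by (intro fps_ext) (auto simp: dirichlet_unit_def)

lemma bell_series_dirichlet_inverse:
  assumes "prime p" "f 1 \<noteq> 0"
  shows "bell_series p f * bell_series p (dirichlet_inverse f) = 1"
  using assms
  by (simp add: dirichlet_conv_inverse bell_series_dirichlet_unit flip: bell_series_dirichlet_conv)

lemma bell_series_dirichlet_product:
  assumes "prime p"
  shows "bell_series p (dirichlet_product fs) = prod_list (map (bell_series p) fs)"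
  by (induction fs)
     (simp_all add: dirichlet_product_def assms bell_series_dirichlet_unit bell_series_dirichlet_conv)

text \<open>The Bell series is geometric with ratio \<open>\<beta> p\<close>. The product form
  avoids division of power series and lets the linear factors be multiplied up later.\<close>

lemma bell_series_degree_one:
  assumes "degree_one_at p \<beta>"
  shows "fps_of_poly [:1, - \<beta> p:] * bell_series p \<beta> = 1"
proof -
  obtain b where "\<And>n. \<beta> (p ^ n) = b ^ n"
    using assms by (auto simp: degree_one_at_def)
  moreover from this[of 1] have "\<beta> p = b" by simp
  ultimately have "bell_series p \<beta> = Abs_fps (\<lambda>n. \<beta> p ^ n)"
    by (simp add: bell_series_def)
  moreover have "fps_of_poly [:1, - \<beta> p:] = 1 - fps_const (\<beta> p) * fps_X"
    by (simp add: fps_of_poly_pCons flip: fps_const_neg)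
  moreover have "(1 - fps_const c * fps_X) * Abs_fps (\<lambda>n. c ^ n) = 1" for c :: complex
  proof (rule fps_ext)
    fix n
    show "((1 - fps_const c * fps_X) * Abs_fps (\<lambda>n. c ^ n)) $ n = 1 $ n"
      by (cases n) (simp_all add: left_diff_distrib mult.assoc)
  qed
  ultimately show ?thesis by (simp only:)
qed

lemma degree_one_at_nonzero:
  assumes "degree_one_at p \<beta>"
  shows "\<beta> p \<noteq> 0"
proof -
  obtain b where "b \<noteq> 0" "\<And>n. \<beta> (p ^ n) = b ^ n"
    using assms by (auto simp: degree_one_at_def)
  with this(2)[of 1] show ?thesis by simp
qed

section \<open>Linear factors\<close>

text \<open>Each factor has constant coefficient 1, so the roots are the reciprocals of the non-zero
  entries; an entry 0 contributes only the constant 1.\<close>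

definition linear_factors :: "complex list \<Rightarrow> complex poly" where
  "linear_factors bs = prod_list (map (\<lambda>b. [:1, - b:]) bs)"

lemma poly_linear_factors_eq_0_iff:
  "poly (linear_factors bs) x = 0 \<longleftrightarrow> (\<exists>b\<in>set bs. b * x = 1)"
  by (induction bs) (auto simp: linear_factors_def mult.commute)

text \<open>The reciprocal of \<open>b\<close> is a root of the first product; under divisibility it
  would be a root of the second, which forces \<open>b\<close> into \<open>cs\<close>.\<close>

lemma linear_factors_not_dvd:
  assumes "b \<in> set bs" "b \<noteq> 0" "b \<notin> set cs"
  shows "\<not> linear_factors bs dvd linear_factors cs"
proof
  assume dvd: "linear_factors bs dvd linear_factors cs"
  have "poly (linear_factors bs) (inverse b) = 0"
    using assms(1,2) by (auto simp: poly_linear_factors_eq_0_iff intro!: bexI[of _ b])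
  with dvd have "poly (linear_factors cs) (inverse b) = 0"
    by (metis dvdE mult_zero_left poly_mult)
  then obtain c where "c \<in> set cs" "c * inverse b = 1"
    by (auto simp: poly_linear_factors_eq_0_iff)
  thus False
    using assms(2,3) by (simp add: field_simps)
qed

text \<open>A power series with finite support is a polynomial, and the embedding of polynomials
  into power series is injective, so the identity is already one of polynomials.\<close>

lemma fps_finite_support_dvd:
  fixes P Q :: "complex poly"
  assumes "fps_of_poly Q * F = fps_of_poly P" "finite {n. F $ n \<noteq> 0}"
  shows "Q dvd P"
proof -
  define R where "R = Abs_poly (fps_nth F)"
  have "fps_of_poly R = F"
    using assms(2) unfolding R_def
    by (intro fps_ext) (simp add: Abs_poly_inverse eventually_cofinite)
  hence "P = Q * R"
    using assms(1) by (simp add: fps_of_poly_mult flip: fps_of_poly_eq_iff)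
  thus ?thesis by simp
qed

text \<open>Each linear factor on the left cancels the geometric series of one
  \<open>\<beta>\<close>, while the inverse of each \<open>\<gamma>\<close> has a linear polynomial
  as its Bell series.\<close>

lemma bell_series_mixed_product:
  assumes "prime p"
    and "\<forall>\<beta>\<in>set \<beta>s. degree_one_at p \<beta>" and "\<forall>\<gamma>\<in>set \<gamma>s. degree_one_at p \<gamma>"
  shows "fps_of_poly (linear_factors (map (\<lambda>\<beta>. \<beta> p) \<beta>s)) *
           bell_series p (dirichlet_product (\<beta>s @ map dirichlet_inverse \<gamma>s)) =
         fps_of_poly (linear_factors (map (\<lambda>\<gamma>. \<gamma> p) \<gamma>s))"
proof -
  have inv: "bell_series p (dirichlet_inverse \<gamma>) = fps_of_poly [:1, - \<gamma> p:]"
    if "\<gamma> \<in> set \<gamma>s" for \<gamma>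
  proof -
    have \<gamma>: "degree_one_at p \<gamma>" using assms(3) that by blast
    hence "\<gamma> 1 \<noteq> 0" by (simp add: degree_one_at_def multiplicative_fun_1 del: One_nat_def)
    hence "bell_series p \<gamma> * bell_series p (dirichlet_inverse \<gamma>) = 1"
      by (rule bell_series_dirichlet_inverse[OF assms(1)])
    moreover have "bell_series p \<gamma> * fps_of_poly [:1, - \<gamma> p:] = 1"
      using bell_series_degree_one[OF \<gamma>] by (simp only: mult.commute)
    \<comment> \<open>Both series are inverse to \<open>bell_series p \<gamma>\<close>, which is
      non-zero and so can be cancelled.\<close>
    ultimately show ?thesis
      by (metis mult_cancel_left mult_zero_left zero_neq_one)
  qed
  have "fps_of_poly (linear_factors (map (\<lambda>\<beta>. \<beta> p) \<beta>s)) * prod_list (map (bell_series p) \<beta>s) = 1"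
    using assms(2)
  proof (induction \<beta>s)
    case (Cons \<beta> \<beta>s)
    have "fps_of_poly (linear_factors (map (\<lambda>\<beta>. \<beta> p) (\<beta> # \<beta>s))) *
            prod_list (map (bell_series p) (\<beta> # \<beta>s)) =
          (fps_of_poly [:1, - \<beta> p:] * bell_series p \<beta>) *
          (fps_of_poly (linear_factors (map (\<lambda>\<beta>. \<beta> p) \<beta>s)) * prod_list (map (bell_series p) \<beta>s))"
      by (simp only: linear_factors_def list.map prod_list.Cons fps_of_poly_mult mult_ac)
    thus ?case using Cons by (simp add: bell_series_degree_one)
  qed (simp add: linear_factors_def)
  moreover have "prod_list (map (\<lambda>\<gamma>. bell_series p (dirichlet_inverse \<gamma>)) \<gamma>s) =
      fps_of_poly (linear_factors (map (\<lambda>\<gamma>. \<gamma> p) \<gamma>s))"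
    using inv by (simp add: linear_factors_def fps_of_poly_prod_list o_def cong: map_cong)
  ultimately show ?thesis
    by (simp add: bell_series_dirichlet_product[OF assms(1)] o_def flip: mult.assoc)
qed

section \<open>The recurrence of the generalized Fibonacci polynomials\<close>

lemma weighted_tuples_sum_mono:
  assumes "b \<in> weighted_tuples m" "m \<le> n"
  shows "(\<Sum>j=1..n. j * b j) = m"
proof -
  have "(\<Sum>j=1..n. j * b j) = (\<Sum>j=1..m. j * b j)"
    using assms by (intro sum.mono_neutral_right) (auto simp: weighted_tuples_def)
  thus ?thesis using assms by (simp add: weighted_tuples_def)
qed

text \<open>Entries beyond \<open>m\<close> are 0 and contribute trivially. A common index range
  makes terms of \<open>gen_fib (n - k)\<close> and \<open>gen_fib n\<close> comparable.\<close>

lemma gen_fib_extend: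
  assumes "m \<le> n"
  shows "gen_fib m t = (\<Sum>b\<in>weighted_tuples m.
           (fact (\<Sum>j=1..n. b j) / (\<Prod>j=1..n. fact (b j))) * (\<Prod>j=1..n. t j ^ b j))"
  unfolding gen_fib_def
proof (rule sum.cong[OF refl])
  fix b assume "b \<in> weighted_tuples m"
  hence z: "b j = 0" if "j \<in> {1..n} - {1..m}" for j
    using that by (auto simp: weighted_tuples_def)
  have sub: "{1..m} \<subseteq> {1..n}" using assms by auto
  have "(\<Sum>j=1..m. b j) = (\<Sum>j=1..n. b j)"
    using z sub by (intro sum.mono_neutral_left) auto
  moreover have "(\<Prod>j=1..m. fact (b j)) = (\<Prod>j=1..n. fact (b j) :: complex)"
    using z sub by (intro prod.mono_neutral_left) auto
  moreover have "(\<Prod>j=1..m. t j ^ b j) = (\<Prod>j=1..n. t j ^ b j)"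
    using z sub by (intro prod.mono_neutral_left) auto
  ultimately show "fact (\<Sum>j=1..m. b j) / (\<Prod>j=1..m. fact (b j)) * (\<Prod>j=1..m. t j ^ b j) =
      fact (\<Sum>j=1..n. b j) / (\<Prod>j=1..n. fact (b j)) * (\<Prod>j=1..n. t j ^ b j)"
    by (simp only:)
qed

text \<open>Raising \<open>b k\<close> by one multiplies the factorial of the total by the new
  total, the denominator by the new entry \<open>a k\<close>, and the monomial by
  \<open>t k\<close>.\<close>

lemma multinomial_term_Suc:
  fixes t :: "nat \<Rightarrow> complex" and b :: "nat \<Rightarrow> nat"
  assumes "finite S" "k \<in> S"
  defines "a \<equiv> b(k := Suc (b k))"
  shows "of_nat (a k) * (fact (\<Sum>j\<in>S. a j) / (\<Prod>j\<in>S. fact (a j)) * (\<Prod>j\<in>S. t j ^ a j)) =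
         of_nat (\<Sum>j\<in>S. a j) *
           (t k * (fact (\<Sum>j\<in>S. b j) / (\<Prod>j\<in>S. fact (b j)) * (\<Prod>j\<in>S. t j ^ b j)))"
proof -
  have s: "(\<Sum>j\<in>S. a j) = Suc (\<Sum>j\<in>S. b j)"
    using assms by (simp add: sum.remove[of S k])
  have f: "(\<Prod>j\<in>S. fact (a j)) = of_nat (a k) * (\<Prod>j\<in>S. fact (b j) :: complex)"
    using assms by (simp add: prod.remove[of S k])
  have t: "(\<Prod>j\<in>S. t j ^ a j) = t k * (\<Prod>j\<in>S. t j ^ b j)"
    using assms by (simp add: prod.remove[of S k])
  have "(of_nat (a k) :: complex) \<noteq> 0" by (simp add: a_def del: of_nat_Suc)
  moreover have "(\<Prod>j\<in>S. fact (b j) :: complex) \<noteq> 0" using assms(1) by simp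
  ultimately show ?thesis
    unfolding s f t fact_Suc by (simp add: field_simps del: of_nat_Suc)
qed

lemma weighted_sum_increment:
  fixes b :: "nat \<Rightarrow> nat"
  assumes "finite S" "k \<in> S"
  shows "(\<Sum>j\<in>S. j * (b(k := Suc (b k))) j) = k + (\<Sum>j\<in>S. j * b j)"
  using assms by (simp add: sum.remove[of S k])

lemma weighted_tuples_increment:
  assumes "k \<in> {1..n}"
  shows "bij_betw (\<lambda>b. b(k := Suc (b k))) (weighted_tuples (n - k))
           {a \<in> weighted_tuples n. a k \<noteq> 0}"
proof (rule bij_betwI[where g = "\<lambda>a. a(k := a k - 1)"])
  show "(\<lambda>b. b(k := Suc (b k))) \<in> weighted_tuples (n - k) \<rightarrow> {a \<in> weighted_tuples n. a k \<noteq> 0}"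
  proof
    fix b assume b: "b \<in> weighted_tuples (n - k)"
    have "(\<Sum>j=1..n. j * (b(k := Suc (b k))) j) = k + (\<Sum>j=1..n. j * b j)"
      using assms by (intro weighted_sum_increment) auto
    also have "\<dots> = n"
      using weighted_tuples_sum_mono[OF b, of n] assms by simp
    finally show "b(k := Suc (b k)) \<in> {a \<in> weighted_tuples n. a k \<noteq> 0}"
      using b assms by (auto simp: weighted_tuples_def)
  qed
next
  show "(\<lambda>a. a(k := a k - 1)) \<in> {a \<in> weighted_tuples n. a k \<noteq> 0} \<rightarrow> weighted_tuples (n - k)"
  proof
    fix a assume a: "a \<in> {a \<in> weighted_tuples n. a k \<noteq> 0}"
    let ?b = "a(k := a k - 1)"
    have "n = (\<Sum>j=1..n. j * a j)" using a by (simp add: weighted_tuples_def)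
    also have "\<dots> = k + (\<Sum>j=1..n. j * ?b j)"
    proof -
      \<comment> \<open>Truncated subtraction is undone here because \<open>a k\<close> is
        non-zero.\<close>
      have "?b(k := Suc (?b k)) = a" using a by auto
      with weighted_sum_increment[of "{1..n}" k ?b] assms show ?thesis
        by (simp only: finite_atLeastAtMost)
    qed
    finally have sum: "(\<Sum>j=1..n. j * ?b j) = n - k" by simp
    \<comment> \<open>For \<open>j\<close> above \<open>n - k\<close>, a positive entry would alone
      contribute more than the total weight \<open>n - k\<close>.\<close>
    have z: "?b j = 0" if "j \<notin> {1..n - k}" for j
    proof (cases "j \<in> {1..n}")
      case True
      hence "j * ?b j \<le> n - k"
        unfolding sum[symmetric] by (intro member_le_sum) auto
      moreover have "j > n - k" using that True by auto
      ultimately show ?thesis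
        by (metis linorder_not_le mult.right_neutral mult_le_mono2 order_trans less_one)
    next
      case False
      thus ?thesis using a by (auto simp: weighted_tuples_def)
    qed
    have "(\<Sum>j=1..n - k. j * ?b j) = (\<Sum>j=1..n. j * ?b j)"
      using z by (intro sum.mono_neutral_left) auto
    thus "?b \<in> weighted_tuples (n - k)"
      using z sum unfolding weighted_tuples_def by simp
  qed
qed auto

text \<open>
  Each multinomial term is split with the weights \<open>a\<^sub>k / (\<Sum>j. a\<^sub>j)\<close>, which add up to \<open>1\<close>; the
  share of \<open>k\<close> is \<open>t\<^sub>k\<close> times the term of the tuple with \<open>a\<^sub>k\<close> lowered by one.
\<close>

lemma gen_fib_recurrence:
  assumes "n > 0"
  shows "gen_fib n t = (\<Sum>k=1..n. t k * gen_fib (n - k) t)"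
proof -
  define N where "N a = (\<Sum>j=1..n. a j)" for a :: "nat \<Rightarrow> nat"
  define M where
    "M a = (fact (N a) / (\<Prod>j=1..n. fact (a j))) * (\<Prod>j=1..n. t j ^ a j)" for a
  \<comment> \<open>The weights have denominator \<open>N a\<close>; positivity of \<open>n\<close>
    excludes the zero tuple.\<close>
  have N_pos: "N a \<noteq> 0" if "a \<in> weighted_tuples n" for a
  proof
    assume "N a = 0"
    hence "\<forall>j\<in>{1..n}. a j = 0" by (simp add: N_def)
    hence "(\<Sum>j=1..n. j * a j) = 0" by simp
    thus False using that assms by (simp add: weighted_tuples_def)
  qed
  have shift: "t k * gen_fib (n - k) t =
      (\<Sum>a\<in>weighted_tuples n. of_nat (a k) / of_nat (N a) * M a)" if k: "k \<in> {1..n}" for k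
  proof -
    \<comment> \<open>Tuples with \<open>a k = 0\<close> have weight 0; those left are the image of
      the increment bijection.\<close>
    have "(\<Sum>a\<in>weighted_tuples n. of_nat (a k) / of_nat (N a) * M a) =
          (\<Sum>a | a \<in> weighted_tuples n \<and> a k \<noteq> 0. of_nat (a k) / of_nat (N a) * M a)"
      by (intro sum.mono_neutral_right finite_weighted_tuples) auto
    also have "\<dots> = (\<Sum>b\<in>weighted_tuples (n - k). t k * M b)"
    proof (rule sum.reindex_bij_betw[OF weighted_tuples_increment[OF k], symmetric, THEN trans],
        rule sum.cong[OF refl])
      fix b assume "b \<in> weighted_tuples (n - k)"
      let ?a = "b(k := Suc (b k))"
      have "N ?a \<noteq> 0" using k by (auto simp: N_def)
      moreover have "of_nat (?a k) * M ?a = of_nat (N ?a) * (t k * M b)"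
        unfolding M_def N_def by (rule multinomial_term_Suc) (use k in auto)
      ultimately show "of_nat (?a k) / of_nat (N ?a) * M ?a = t k * M b"
        by (simp add: field_simps del: fun_upd_apply of_nat_Suc)
    qed
    also have "\<dots> = t k * gen_fib (n - k) t"
      by (simp add: gen_fib_extend[of "n - k" n] M_def N_def sum_distrib_left)
    finally show ?thesis ..
  qed
  have "gen_fib n t = (\<Sum>a\<in>weighted_tuples n. M a)"
    by (simp add: gen_fib_def M_def N_def)
  also have "\<dots> = (\<Sum>a\<in>weighted_tuples n. \<Sum>k=1..n. of_nat (a k) / of_nat (N a) * M a)"
  proof (rule sum.cong[OF refl])
    fix a assume "a \<in> weighted_tuples n"
    hence "(of_nat (N a) :: complex) \<noteq> 0" using N_pos by simp
    moreover have "(\<Sum>k=1..n. of_nat (a k)) = (of_nat (N a) :: complex)" by (simp add: N_def)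
    ultimately show "M a = (\<Sum>k=1..n. of_nat (a k) / of_nat (N a) * M a)"
      by (simp flip: sum_distrib_right sum_divide_distrib)
  qed
  also have "\<dots> = (\<Sum>k=1..n. t k * gen_fib (n - k) t)"
    by (subst sum.swap) (simp add: shift)
  finally show ?thesis .
qed

text \<open>With \<open>t 0 = 0\<close> the Cauchy product starts at index 1 and agrees with the
  recurrence for \<open>n > 0\<close>; at \<open>n = 0\<close> the subtracted 1 accounts for
  \<open>gen_fib 0 t = 1\<close>.\<close>

lemma gen_fib_generating_function:
  assumes "t 0 = 0"
  shows "Abs_fps (\<lambda>n. gen_fib n t) * (1 - Abs_fps t) = 1"
proof -
  have "Abs_fps t * Abs_fps (\<lambda>n. gen_fib n t) = Abs_fps (\<lambda>n. gen_fib n t) - 1"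
  proof (rule fps_ext)
    fix n
    show "(Abs_fps t * Abs_fps (\<lambda>n. gen_fib n t)) $ n = (Abs_fps (\<lambda>n. gen_fib n t) - 1) $ n"
      using assms gen_fib_recurrence[of n t]
      by (cases "n = 0") (simp_all add: fps_mult_nth sum.atLeast_Suc_atMost)
  qed
  thus ?thesis by (simp add: algebra_simps)
qed

theorem corollary12:
  fixes p r s :: nat and \<alpha> :: "nat \<Rightarrow> complex"
  assumes "prime p"
    and "multiplicative_fun \<alpha>"
    and "normal_form_product_at p \<alpha> r s"
    and "r \<ge> 1" and "s \<ge> 1"
  shows "type4_at p \<alpha>"
proof -
  obtain \<beta>s \<gamma>s where len: "length \<beta>s = r" "length \<gamma>s = s"
    and \<beta>s: "\<forall>\<beta>\<in>set \<beta>s. degree_one_at p \<beta>" and \<gamma>s: "\<forall>\<gamma>\<in>set \<gamma>s. degree_one_at p \<gamma>"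
    and ne: "\<forall>\<beta>\<in>set \<beta>s. \<forall>\<gamma>\<in>set \<gamma>s. \<beta> p \<noteq> \<gamma> p"
    and \<alpha>: "\<And>n. \<alpha> (p ^ n) = dirichlet_product (\<beta>s @ map dirichlet_inverse \<gamma>s) (p ^ n)"
    using assms(3) by (auto simp: normal_form_product_at_def)
  define Q where "Q = linear_factors (map (\<lambda>\<beta>. \<beta> p) \<beta>s)"
  define P where "P = linear_factors (map (\<lambda>\<gamma>. \<gamma> p) \<gamma>s)"
  define A where "A = bell_series p \<alpha>"
  define T where "T = Abs_fps (parameters p \<alpha>)"
  \<comment> \<open>Being mixed supplies a factor of each kind, hence a root of \<open>Q\<close> and
    a root of \<open>P\<close>; normal form keeps the two root sets disjoint.\<close>
  obtain \<beta> \<gamma> where \<beta>: "\<beta> \<in> set \<beta>s" and \<gamma>: "\<gamma> \<in> set \<gamma>s"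
    using len assms(4,5) by (cases \<beta>s; cases \<gamma>s) auto
  have ndvd: "\<not> Q dvd P" "\<not> P dvd Q"
    unfolding P_def Q_def
  proof -
    show "\<not> linear_factors (map (\<lambda>\<beta>. \<beta> p) \<beta>s) dvd linear_factors (map (\<lambda>\<gamma>. \<gamma> p) \<gamma>s)"
      by (rule linear_factors_not_dvd[of "\<beta> p"])
         (use \<beta> ne \<beta>s degree_one_at_nonzero[of p \<beta>] in auto)
    show "\<not> linear_factors (map (\<lambda>\<gamma>. \<gamma> p) \<gamma>s) dvd linear_factors (map (\<lambda>\<beta>. \<beta> p) \<beta>s)"
      by (rule linear_factors_not_dvd[of "\<gamma> p"])
         (use \<gamma> ne \<gamma>s degree_one_at_nonzero[of p \<gamma>] in force)+
  qed
  have QA: "fps_of_poly Q * A = fps_of_poly P"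
    using bell_series_mixed_product[OF assms(1) \<beta>s \<gamma>s]
    by (simp add: A_def P_def Q_def bell_series_def \<alpha>)
  have \<alpha>1: "\<alpha> 1 = 1" using assms(2) by (rule multiplicative_fun_1)
  have AT: "A * (1 - T) = 1"
    using gen_fib_generating_function[of "parameters p \<alpha>"] parameters_0[of \<alpha> p, OF \<alpha>1]
    by (simp add: A_def T_def bell_series_def gen_fib_parameters[of \<alpha>, OF \<alpha>1])
  have PT: "fps_of_poly P * (1 - T) = fps_of_poly Q"
    unfolding QA[symmetric] by (simp add: AT mult.assoc)
  have "infinite {n. \<alpha> (p ^ n) \<noteq> 0}"
    using fps_finite_support_dvd[OF QA] ndvd(1) by (auto simp: A_def)
  moreover have "infinite {j. j \<ge> 1 \<and> parameters p \<alpha> j \<noteq> 0}"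
  proof
    assume "finite {j. j \<ge> 1 \<and> parameters p \<alpha> j \<noteq> 0}"
    \<comment> \<open>For \<open>j \<ge> 1\<close> the coefficient is minus the parameter; the
      constant term adds at most the index 0, which leaves the support finite.\<close>
    moreover have "{j. (1 - T) $ j \<noteq> 0} \<subseteq> insert 0 {j. j \<ge> 1 \<and> parameters p \<alpha> j \<noteq> 0}"
      by (auto simp: T_def)
    ultimately have "finite {j. (1 - T) $ j \<noteq> 0}" by (meson finite_insert finite_subset)
    with fps_finite_support_dvd[OF PT] ndvd(2) show False by blast
  qed
  ultimately show ?thesis by (simp add: type4_at_def)
qed

end
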